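(* Let $X$ be a set. (1) A magma $(X,\cdot)$ is a right P{\l}onka magma if and only if there exist a partition $X=\coprod_{i\in I}X_i$ and a tuple $(f_i^j)_{(i,j)\in I\times I}$ of functions $f_i^j:X_i\to X_i$ such that $$f_i^j\circ f_i^k=f_i^k\circ f_i^j\qquad\text{for all } i,j,k\in I,$$ and the multiplication is given by $$x_i\cdot x_j=f_i^j(x_i)\qquad\text{for all } x_i\in X_i,\ x_j\in X_j,\ i,j\in I.$$ Moreover, for a right P{\l}onka magma $(X,\cdot)$ described by data $(X_i)_{i\in I}$, $(f_i^j)_{(i,j)\in I\times I}$ as in (1): (2) $(X,\cdot)$ is right involutory if and only if $f_i^j:X_i\to X_i$ is an involution on $X_i$ for all $i,j\in I$; (3) $(X,\cdot)$ is a band if and only if $f_i^i=\mathrm{Id}_{X_i}$ for all $i\in I$; (4) $(X,\cdot)$ is a $2$-cyclic magma if and only if $f_i^j:X_i\to X_i$ is an involution and $f_i^i=\mathrm{Id}_{X_i}$ for all $i,j\in I$.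
   Context: A magma is a set with a binary operation. A right P{\l}onka magma is a magma $(X,\cdot)$ with $(x\cdot y)\cdot z=(x\cdot z)\cdot y$ and $x\cdot(y\cdot z)=x\cdot y$ for all $x,y,z\in X$. A magma is right involutory if $(x\cdot y)\cdot y=x$ for all $x,y$, and a band (idempotent) if $x\cdot x=x$ for all $x$. A $2$-cyclic magma is a right P{\l}onka magma which is both right involutory and a band. An involution on a set $Y$ is a map $h:Y\to Y$ with $h\circ h=\mathrm{Id}_Y$ (the identity is allowed). The parts of a partition are non-empty. *)

theory Defs
  imports Main "HOL-Library.FuncSet" "HOL-Library.Disjoint_Sets"
begin

definition magma :: "'a set \<Rightarrow> ('a \<Rightarrow> 'a \<Rightarrow> 'a) \<Rightarrow> bool" where
  "magma X m \<longleftrightarrow> (\<forall>x\<in>X. \<forall>y\<in>X. m x y \<in> X)"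

definition right_plonka_magma :: "'a set \<Rightarrow> ('a \<Rightarrow> 'a \<Rightarrow> 'a) \<Rightarrow> bool" where
  "right_plonka_magma X m \<longleftrightarrow> magma X m \<and>
     (\<forall>x\<in>X. \<forall>y\<in>X. \<forall>z\<in>X. m (m x y) z = m (m x z) y) \<and>
     (\<forall>x\<in>X. \<forall>y\<in>X. \<forall>z\<in>X. m x (m y z) = m x y)"

definition right_involutory :: "'a set \<Rightarrow> ('a \<Rightarrow> 'a \<Rightarrow> 'a) \<Rightarrow> bool" where
  "right_involutory X m \<longleftrightarrow> (\<forall>x\<in>X. \<forall>y\<in>X. m (m x y) y = x)"

definition band :: "'a set \<Rightarrow> ('a \<Rightarrow> 'a \<Rightarrow> 'a) \<Rightarrow> bool" where
  "band X m \<longleftrightarrow> (\<forall>x\<in>X. m x x = x)"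

definition two_cyclic_magma :: "'a set \<Rightarrow> ('a \<Rightarrow> 'a \<Rightarrow> 'a) \<Rightarrow> bool" where
  "two_cyclic_magma X m \<longleftrightarrow>
     right_plonka_magma X m \<and> right_involutory X m \<and> band X m"

definition involution_on :: "'a set \<Rightarrow> ('a \<Rightarrow> 'a) \<Rightarrow> bool" where
  "involution_on Y h \<longleftrightarrow> h \<in> Y \<rightarrow> Y \<and> (\<forall>y\<in>Y. h (h y) = y)"

definition indexed_partition :: "'a set \<Rightarrow> 'i set \<Rightarrow> ('i \<Rightarrow> 'a set) \<Rightarrow> bool" where
  "indexed_partition X I P \<longleftrightarrow>
     (\<Union>i\<in>I. P i) = X \<and> disjoint_family_on P I \<and> (\<forall>i\<in>I. P i \<noteq> {})"

text \<open>\<open>f i j\<close> is the map with lower index \<open>i\<close> and upper index \<open>j\<close>, a self-map of \<open>P i\<close>.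
  It is a total function in HOL, so equalities between such maps are stated pointwise
  on \<open>P i\<close>; its values elsewhere are irrelevant.\<close>

definition plonka_data ::
  "'a set \<Rightarrow> ('a \<Rightarrow> 'a \<Rightarrow> 'a) \<Rightarrow> 'i set \<Rightarrow> ('i \<Rightarrow> 'a set) \<Rightarrow> ('i \<Rightarrow> 'i \<Rightarrow> 'a \<Rightarrow> 'a) \<Rightarrow> bool" where
  "plonka_data X m I P f \<longleftrightarrow>
     indexed_partition X I P \<and>
     (\<forall>i\<in>I. \<forall>j\<in>I. f i j \<in> P i \<rightarrow> P i) \<and>
     (\<forall>i\<in>I. \<forall>j\<in>I. \<forall>k\<in>I. \<forall>x\<in>P i. (f i j \<circ> f i k) x = (f i k \<circ> f i j) x) \<and>
     (\<forall>i\<in>I. \<forall>j\<in>I. \<forall>x\<in>P i. \<forall>y\<in>P j. m x y = f i j x)"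

text \<open>HOL cannot quantify existentially over the type of the index set. Since parts are
  non-empty and disjoint, every index set injects into \<open>X\<close>, so index sets of
  type \<open>'a set\<close> suffice for asserting existence; statements about given data should
  allow an arbitrary index type.\<close>

end

theory Submission
  imports Defs
begin

text \<open>Call two elements equivalent when right multiplication by them is the same map on \<open>X\<close>.
  The identity \<open>x \<cdot> (y \<cdot> z) = x \<cdot> y\<close> says that \<open>y \<cdot> z\<close> is equivalent to \<open>y\<close>, so every class is
  stable under all right multiplications, and the other identity says that right
  multiplications commute.\<close>

lemma plonka_data_if_right_plonka_magma:
  fixes X :: "'a set"
  assumes "right_plonka_magma X m"
  shows "\<exists>(I :: 'a set) P f. plonka_data X m I P f"
proof -
  define rep where "rep x = (SOME y. y \<in> X \<and> (\<forall>z\<in>X. m z y = m z x))" for x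
  define P where "P i = {y \<in> X. \<forall>z\<in>X. m z y = m z i}" for i
  have rep: "rep x \<in> X \<and> (\<forall>z\<in>X. m z (rep x) = m z x)" if "x \<in> X" for x
    unfolding rep_def by (rule someI[of _ x]) (use that in simp)
  \<comment> \<open>For equivalent elements the predicates under \<open>SOME\<close> coincide, so
    the same element is chosen.\<close>
  have rep_cong: "rep x = rep y" if "\<forall>z\<in>X. m z x = m z y" for x y
    unfolding rep_def using that by (metis (no_types, lifting))
  have I_sub: "i \<in> X" if "i \<in> rep ` X" for i
    using that rep by blast
  have "indexed_partition X (rep ` X) P"
    unfolding indexed_partition_def
  proof (intro conjI ballI)
    show "(\<Union>i\<in>rep ` X. P i) = X"
      using rep by (fastforce simp: P_def)
    show "disjoint_family_on P (rep ` X)"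
      unfolding disjoint_family_on_def
    proof (intro ballI impI)
      fix i j
      assume ij: "i \<in> rep ` X" "j \<in> rep ` X" "i \<noteq> j"
      then obtain x y where xy: "x \<in> X" "i = rep x" "y \<in> X" "j = rep y"
        by blast
      show "P i \<inter> P j = {}"
      proof (rule ccontr)
        assume "P i \<inter> P j \<noteq> {}"
        then obtain u where "u \<in> P i" "u \<in> P j"
          by blast
        \<comment> \<open>Both sides equal \<open>m z u\<close>, since \<open>u\<close> is
          equivalent to \<open>rep x\<close> and to \<open>rep y\<close>.\<close>
        then have "\<forall>z\<in>X. m z x = m z y"
          using xy rep unfolding P_def by simp
        then show False
          using rep_cong xy ij(3) by blast
      qed
    qed
    show "P i \<noteq> {}" if "i \<in> rep ` X" for i
      using I_sub[OF that] by (auto simp: P_def)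
  qed
  \<comment> \<open>The map \<open>f i j\<close> is right multiplication by the representative
    \<open>j\<close>, whatever \<open>i\<close> is; any \<open>y\<close> in \<open>P j\<close>
    multiplies in the same way by definition of the class.\<close>
  then have "plonka_data X m (rep ` X) P (\<lambda>i j x. m x j)"
    using assms I_sub
    by (auto simp: plonka_data_def right_plonka_magma_def magma_def P_def)
  then show ?thesis
    by blast
qed

lemma plonka_dataD:
  assumes "plonka_data X m I P f"
  shows plonka_data_in: "\<And>i x. i \<in> I \<Longrightarrow> x \<in> P i \<Longrightarrow> x \<in> X"
    and plonka_data_cases: "\<And>x. x \<in> X \<Longrightarrow> \<exists>i\<in>I. x \<in> P i"
    and plonka_data_nonempty: "\<And>i. i \<in> I \<Longrightarrow> \<exists>x. x \<in> P i"
    and plonka_data_closed: "\<And>i j x. i \<in> I \<Longrightarrow> j \<in> I \<Longrightarrow> x \<in> P i \<Longrightarrow> f i j x \<in> P i"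
    and plonka_data_commute: "\<And>i j k x. i \<in> I \<Longrightarrow> j \<in> I \<Longrightarrow> k \<in> I \<Longrightarrow> x \<in> P i \<Longrightarrow>
      f i j (f i k x) = f i k (f i j x)"
    and plonka_data_mult: "\<And>i j x y. i \<in> I \<Longrightarrow> j \<in> I \<Longrightarrow> x \<in> P i \<Longrightarrow> y \<in> P j \<Longrightarrow>
      m x y = f i j x"
  using assms unfolding plonka_data_def indexed_partition_def o_def by blast+

text \<open>A product stays in the part of its left factor. Hence both iterated products in the
  first identity are composites of \<open>f i j\<close> and \<open>f i k\<close>, which commute, and
  multiplying by \<open>m y z\<close> or by \<open>y\<close> applies the same map
  \<open>f i j\<close>.\<close>

lemma right_plonka_magma_if_plonka_data:
  assumes d: "plonka_data X m I P f"
  shows "right_plonka_magma X m"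
  unfolding right_plonka_magma_def magma_def
proof (intro conjI ballI)
  note mult = plonka_data_mult[OF d] and closed = plonka_data_closed[OF d]
  fix x y
  assume "x \<in> X" "y \<in> X"
  then obtain i j where ij: "i \<in> I" "x \<in> P i" "j \<in> I" "y \<in> P j"
    using plonka_data_cases[OF d] by blast
  show "m x y \<in> X"
    using ij by (simp add: mult closed plonka_data_in[OF d, of i])
  fix z
  assume "z \<in> X"
  then obtain k where k: "k \<in> I" "z \<in> P k"
    using plonka_data_cases[OF d] by blast
  show "m (m x y) z = m (m x z) y"
    using ij k by (simp add: mult closed plonka_data_commute[OF d, of i j k])
  show "m x (m y z) = m x y"
    using ij k by (simp add: mult[of i j] mult[of j k] closed)
qed

lemma right_involutory_iff_plonka_data:
  assumes d: "plonka_data X m I P f"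
  shows "right_involutory X m \<longleftrightarrow> (\<forall>i\<in>I. \<forall>j\<in>I. involution_on (P i) (f i j))"
proof
  note mult = plonka_data_mult[OF d] and closed = plonka_data_closed[OF d]
  show "\<forall>i\<in>I. \<forall>j\<in>I. involution_on (P i) (f i j)" if inv: "right_involutory X m"
    unfolding involution_on_def
  proof (intro ballI conjI)
    fix i j
    assume ij: "i \<in> I" "j \<in> I"
    show "f i j \<in> P i \<rightarrow> P i"
      using closed ij by blast
    fix x
    assume x: "x \<in> P i"
    \<comment> \<open>Non-emptiness of the part supplies an element whose right multiplication
      realises \<open>f i j\<close> on \<open>P i\<close>.\<close>
    obtain y where y: "y \<in> P j"
      using plonka_data_nonempty[OF d ij(2)] by blast
    have "m (m x y) y = x"
      using inv plonka_data_in[OF d] ij x y unfolding right_involutory_def by blast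
    then show "f i j (f i j x) = x"
      using ij x y by (simp add: mult closed)
  qed
  show "right_involutory X m" if "\<forall>i\<in>I. \<forall>j\<in>I. involution_on (P i) (f i j)"
    unfolding right_involutory_def
  proof (intro ballI)
    fix x y
    assume "x \<in> X" "y \<in> X"
    then obtain i j where "i \<in> I" "x \<in> P i" "j \<in> I" "y \<in> P j"
      using plonka_data_cases[OF d] by blast
    then show "m (m x y) y = x"
      using that mult closed by (simp add: involution_on_def)
  qed
qed

text \<open>Squaring acts on \<open>P i\<close> as the diagonal map \<open>f i i\<close>, and the
  parts cover \<open>X\<close>.\<close>

lemma band_iff_plonka_data:
  assumes d: "plonka_data X m I P f"
  shows "band X m \<longleftrightarrow> (\<forall>i\<in>I. \<forall>x\<in>P i. f i i x = x)"
  using plonka_data_mult[OF d] plonka_data_cases[OF d] plonka_data_in[OF d]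
  unfolding band_def by metis


theorem theorem3p13:
  fixes X :: "'a set" and m :: "'a \<Rightarrow> 'a \<Rightarrow> 'a"
  assumes "magma X m"
  shows "(right_plonka_magma X m \<longleftrightarrow>
            (\<exists>(I :: 'a set) P f. plonka_data X m I P f)) \<and>
         (\<forall>(I :: 'i set) P f. plonka_data X m I P f \<longrightarrow> right_plonka_magma X m) \<and>
         (\<forall>(I :: 'i set) P f. right_plonka_magma X m \<and> plonka_data X m I P f \<longrightarrow>
            (right_involutory X m \<longleftrightarrow> (\<forall>i\<in>I. \<forall>j\<in>I. involution_on (P i) (f i j))) \<and>
            (band X m \<longleftrightarrow> (\<forall>i\<in>I. \<forall>x\<in>P i. f i i x = x)) \<and>
            (two_cyclic_magma X m \<longleftrightarrow>
               (\<forall>i\<in>I. \<forall>j\<in>I. involution_on (P i) (f i j) \<and> (\<forall>x\<in>P i. f i i x = x))))"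
proof (intro conjI allI impI)
  show "right_plonka_magma X m \<longleftrightarrow> (\<exists>(I :: 'a set) P f. plonka_data X m I P f)"
    using plonka_data_if_right_plonka_magma right_plonka_magma_if_plonka_data by blast
next
  fix I :: "'i set" and P f
  assume "plonka_data X m I P f"
  then show "right_plonka_magma X m"
    by (rule right_plonka_magma_if_plonka_data)
next
  fix I :: "'i set" and P f
  assume "right_plonka_magma X m \<and> plonka_data X m I P f"
  then have rp: "right_plonka_magma X m" and d: "plonka_data X m I P f"
    by blast+
  note inv = right_involutory_iff_plonka_data[OF d] and idem = band_iff_plonka_data[OF d]
  show "right_involutory X m \<longleftrightarrow> (\<forall>i\<in>I. \<forall>j\<in>I. involution_on (P i) (f i j))"
    by (rule inv)
  show "band X m \<longleftrightarrow> (\<forall>i\<in>I. \<forall>x\<in>P i. f i i x = x)"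
    by (rule idem)
  show "two_cyclic_magma X m \<longleftrightarrow>
      (\<forall>i\<in>I. \<forall>j\<in>I. involution_on (P i) (f i j) \<and> (\<forall>x\<in>P i. f i i x = x))"
    \<comment> \<open>The identity clause stands under the quantifier over \<open>j\<close>; taking
      \<open>j = i\<close> extracts it for every \<open>i\<close>.\<close>
    unfolding two_cyclic_magma_def inv idem using rp by blast
qed

end
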